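(* Let $A\in\mathbb R^{m\times N}$ have unit columns, let $N\ge3$, and let $\mathcal S=\{1,2\}$. Every nonzero vector $x\in\mathbb R^N_+$ with $\mathrm{supp}(x)=\mathcal S$ is recovered from $y=Ax$ via constrained matching pursuit on $\mathcal P=\mathbb R^N_+$ if and only if the following conditions hold: (i) $A_{\bullet\mathcal S}$ has full column rank, or equivalently $|\vartheta_{12}|<1$; (ii) $\max\big((z_1+\vartheta_{12}z_2)_+,\,(\vartheta_{12}z_1+z_2)_+\big)>\max_{j\in\mathcal S^c}\big(\vartheta_{j1}z_1+\vartheta_{j2}z_2\big)_+$ for all $(z_1,z_2)^T\in\mathbb R^2_{++}$; (iii) $1-\vartheta_{12}^2>\max_{j\in\mathcal S^c}\big((\vartheta_{j2}-\vartheta_{12}\vartheta_{j1})_+,\ (\vartheta_{j1}-\vartheta_{12}\vartheta_{j2})_+\big)$.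
   Context: Unit columns: $\|A_{\bullet i}\|_2=1$ for all $i$, where $A_{\bullet i}$ is the $i$th column; $A_{\bullet\mathcal S}$ is the submatrix of columns indexed by $\mathcal S$. $\vartheta_{ij}:=\langle A_{\bullet i},A_{\bullet j}\rangle$. $a_+=\max(a,0)$. $\mathbb R^n_+$ and $\mathbb R^n_{++}$ are the nonnegative and positive orthants. $\mathrm{supp}(x)=\{i:x_i\ne0\}$; $\mathcal S^c=\{1,\dots,N\}\setminus\mathcal S$; $\mathbf e_j$ is the $j$th standard basis vector. Constrained matching pursuit on $\mathcal P$ with input $y$: $x^0=0$, $\mathcal J_0=\emptyset$; for $k=0,1,\dots$: let $g^*_j=\min\{\|y-A(x^k+t\mathbf e_j)\|_2^2:t\in\mathbb R,\ x^k+t\mathbf e_j\in\mathcal P\}$ for each $j$; choose any $j^*_{k+1}$ minimizing $g^*_j$ over $j\in\{1,\dots,N\}$; set $\mathcal J_{k+1}=\mathcal J_k\cup\{j^*_{k+1}\}$; choose any $x^{k+1}$ minimizing $\|Aw-y\|_2^2$ over $w\in\mathcal P$ with $\mathrm{supp}(w)\subseteq\mathcal J_{k+1}$. Several sequences may be generated due to non-unique choices. "$z$ is recovered" (exact vector recovery of $z$) means: with $y=Az$, along every generated sequence there is an $s$ with $\mathcal J_s=\mathrm{supp}(z)$, and along every sequence, once $\mathcal J_s=\mathrm{supp}(z)$ is reached, the minimization problem defining $x^s$ has the unique solution $x^s=z$. *)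

theory Defs
  imports "HOL-Analysis.Analysis"
begin

definition unit_columns :: "real^'n^'m \<Rightarrow> bool" where
  "unit_columns A \<longleftrightarrow> (\<forall>i. norm (column i A) = 1)"

definition theta :: "real^'n^'m \<Rightarrow> 'n \<Rightarrow> 'n \<Rightarrow> real" where
  "theta A i j = inner (column i A) (column j A)"

text \<open>The \<open>m \<times> 2\<close> submatrix consisting of columns \<open>i\<close> and \<open>j\<close>, in this order.\<close>

definition two_columns :: "real^'n^'m \<Rightarrow> 'n \<Rightarrow> 'n \<Rightarrow> real^2^'m" where
  "two_columns A i j = (\<chi> r. vector [A $ r $ i, A $ r $ j])"

definition supp :: "real^'n \<Rightarrow> 'n set" where
  "supp x = {i. x $ i \<noteq> 0}"

definition nonneg_orthant :: "(real^'n) set" where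
  "nonneg_orthant = {x. \<forall>i. 0 \<le> x $ i}"

abbreviation pos_part :: "real \<Rightarrow> real" where
  "pos_part a \<equiv> max a 0"

text \<open>
  \<open>LEAST\<close> is the minimum of the set of attainable values; it is unspecified if there is
  no minimum. For closed \<open>P\<close> and \<open>x \<in> P\<close> the minimum exists whenever column \<open>j\<close> is nonzero.
\<close>

definition gstar :: "(real^'n) set \<Rightarrow> real^'n^'m \<Rightarrow> real^'m \<Rightarrow> real^'n \<Rightarrow> 'n \<Rightarrow> real" where
  "gstar P A y x j =
     (LEAST v. \<exists>t. x + t *\<^sub>R axis j 1 \<in> P \<and> v = (norm (y - A *v (x + t *\<^sub>R axis j 1)))\<^sup>2)"

definition solutions :: "(real^'n) set \<Rightarrow> real^'n^'m \<Rightarrow> real^'m \<Rightarrow> 'n set \<Rightarrow> (real^'n) set" where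
  "solutions P A y J =
     {x. is_arg_min (\<lambda>w. (norm (A *v w - y))\<^sup>2) (\<lambda>w. w \<in> P \<and> supp w \<subseteq> J) x}"

text \<open>
  The triple \<open>(x, j, J)\<close> is a sequence generated by constrained matching pursuit.
  The choices of \<open>j (Suc k)\<close> and \<open>x (Suc k)\<close> among the minimizers are arbitrary; \<open>j 0\<close> is irrelevant.
\<close>

definition matching_pursuit ::
  "(real^'n) set \<Rightarrow> real^'n^'m \<Rightarrow> real^'m \<Rightarrow>
     (nat \<Rightarrow> real^'n) \<Rightarrow> (nat \<Rightarrow> 'n) \<Rightarrow> (nat \<Rightarrow> 'n set) \<Rightarrow> bool" where
  "matching_pursuit P A y x j J \<longleftrightarrow>
     x 0 = 0 \<and> J 0 = {} \<and>
     (\<forall>k. is_arg_min (gstar P A y (x k)) (\<lambda>_. True) (j (Suc k)) \<and>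
          J (Suc k) = J k \<union> {j (Suc k)} \<and>
          x (Suc k) \<in> solutions P A y (J (Suc k)))"

definition recovered :: "(real^'n) set \<Rightarrow> real^'n^'m \<Rightarrow> real^'n \<Rightarrow> bool" where
  "recovered P A z \<longleftrightarrow>
     (\<forall>x j J. matching_pursuit P A (A *v z) x j J \<longrightarrow>
        (\<exists>s. J s = supp z) \<and>
        (\<forall>s. J s = supp z \<longrightarrow> solutions P A (A *v z) (J s) = {z} \<and> x s = z))"

end

theory Submission
  imports Defs
begin

text \<open>
  For an admissible iterate \<open>x\<close> with residual \<open>r = y - A x\<close>, the selection rule amounts to maximizing
  \<open>(\<langle>r, A\<^sub>j\<rangle>)\<^sub>+\<close>. In the first step \<open>r = y = z\<^sub>1 A\<^sub>1 + z\<^sub>2 A\<^sub>2\<close>, so a selection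
  outside \<open>{1, 2}\<close> is impossible for every \<open>z\<close> exactly under (ii). If column 1 is selected first, the
  residual becomes \<open>z\<^sub>2 (A\<^sub>2 - \<theta>\<^sub>1\<^sub>2 A\<^sub>1)\<close>, whose inner products with
  \<open>A\<^sub>1\<close>, \<open>A\<^sub>2\<close>, \<open>A\<^sub>j\<close> are \<open>0\<close>, \<open>z\<^sub>2 (1 - \<theta>\<^sub>1\<^sub>2\<^sup>2)\<close>,
  \<open>z\<^sub>2 (\<theta>\<^sub>j\<^sub>2 - \<theta>\<^sub>1\<^sub>2 \<theta>\<^sub>j\<^sub>1)\<close>; thus column 2 is the only possible second choice
  exactly under the first half of (iii). For the necessity of (iii) take \<open>z = (1, 1)\<close>: both columns then tie in
  the first step, so each of the two orders occurs in some run.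
\<close>

section \<open>Inner products of unit columns: dependence and rank\<close>

lemma matrix_vector_mult_supp:
  fixes A :: "real^'n^'m"
  assumes "supp w \<subseteq> J"
  shows "A *v w = (\<Sum>i\<in>J. w $ i *\<^sub>R column i A)"
proof -
  have "A *v w = (\<Sum>i\<in>UNIV. w $ i *\<^sub>R column i A)"
    by (simp add: matrix_mult_sum scalar_mult_eq_scaleR)
  also have "\<dots> = (\<Sum>i\<in>J. w $ i *\<^sub>R column i A)"
    using assms by (intro sum.mono_neutral_right) (auto simp: supp_def)
  finally show ?thesis .
qed

lemma theta_commute: "theta A i j = theta A j i"
  by (simp add: theta_def inner_commute)

lemma inner_column_self:
  assumes "unit_columns A"
  shows "inner (column i A) (column i A) = 1"
  using assms by (simp add: unit_columns_def dot_square_norm)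

lemma abs_theta_le_1:
  assumes "unit_columns A"
  shows "\<bar>theta A i j\<bar> \<le> 1"
  using assms Cauchy_Schwarz_ineq2[of "column i A" "column j A"]
  by (simp add: theta_def unit_columns_def)

lemma one_minus_theta_sq_pos:
  assumes "\<bar>theta A i j\<bar> < 1"
  shows "0 < 1 - (theta A i j)\<^sup>2"
  using assms by (simp add: abs_square_less_1)

text \<open>Equality case of Cauchy-Schwarz: the residual of projecting column \<open>p\<close> onto
  column \<open>q\<close> has squared norm \<open>1 - (theta A p q)\<^sup>2\<close>.\<close>

lemma parallel_columns:
  assumes "unit_columns A" "\<not> \<bar>theta A p q\<bar> < 1"
  shows "(theta A p q)\<^sup>2 = 1" "column p A = theta A p q *\<^sub>R column q A"
proof -
  have "\<bar>theta A p q\<bar> = 1"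
    using assms abs_theta_le_1[of A p q] by linarith
  then show sq: "(theta A p q)\<^sup>2 = 1"
    by (metis power2_abs one_power2)
  have "inner (column p A - theta A p q *\<^sub>R column q A)
          (column p A - theta A p q *\<^sub>R column q A) = 1 - (theta A p q)\<^sup>2"
    using inner_column_self[OF assms(1)] theta_commute[of A p q]
    by (simp add: inner_diff_left inner_diff_right theta_def[symmetric] power2_eq_square)
  then show "column p A = theta A p q *\<^sub>R column q A"
    using sq by simp
qed

text \<open>Pairing the relation with both columns gives the homogeneous Gram system, whose
  determinant \<open>1 - (theta A p q)\<^sup>2\<close> is positive.\<close>

lemma independent_columns:
  assumes "unit_columns A" "\<bar>theta A p q\<bar> < 1"
    and "a *\<^sub>R column p A + b *\<^sub>R column q A = 0"
  shows "a = 0 \<and> b = 0"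
proof -
  have "inner (a *\<^sub>R column p A + b *\<^sub>R column q A) (column p A) = 0"
    "inner (a *\<^sub>R column p A + b *\<^sub>R column q A) (column q A) = 0"
    using assms(3) by simp_all
  then have "a + b * theta A p q = 0" "a * theta A p q + b = 0"
    using inner_column_self[OF assms(1)] theta_commute[of A p q]
    by (simp_all add: inner_add_left theta_def[symmetric])
  then have "b * (1 - (theta A p q)\<^sup>2) = 0" "a = - b * theta A p q"
    by algebra+
  then show ?thesis
    using one_minus_theta_sq_pos[OF assms(2)] by simp
qed

lemma rank_two_columns_iff:
  fixes A :: "real^'n^'m"
  assumes "unit_columns A"
  shows "rank (two_columns A p q) = 2 \<longleftrightarrow> \<bar>theta A p q\<bar> < 1"
proof -
  have mult: "two_columns A p q *v v = v $ 1 *\<^sub>R column p A + v $ 2 *\<^sub>R column q A" for v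
    by (simp add: two_columns_def vec_eq_iff matrix_vector_mult_def sum_2 column_def mult.commute)
  have "rank (two_columns A p q) = 2 \<longleftrightarrow> inj ((*v) (two_columns A p q))"
    using full_rank_injective[of "two_columns A p q"] by simp
  also have "\<dots> \<longleftrightarrow> (\<forall>v. two_columns A p q *v v = 0 \<longrightarrow> v = 0)"
    by (simp add: linear_injective_0)
  also have "\<dots> \<longleftrightarrow> \<bar>theta A p q\<bar> < 1"
  proof
    assume inj: "\<forall>v. two_columns A p q *v v = 0 \<longrightarrow> v = 0"
    show "\<bar>theta A p q\<bar> < 1"
    proof (rule ccontr)
      assume "\<not> \<bar>theta A p q\<bar> < 1"
      note par = parallel_columns[OF assms this]
      have "two_columns A p q *v vector [1, - theta A p q] = 0"
        by (simp add: mult par(2))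
      then have "(vector [1, - theta A p q] :: real^2) = 0"
        using inj by blast
      then show False
        by (metis vector_2(1) zero_index zero_neq_one)
    qed
  next
    assume "\<bar>theta A p q\<bar> < 1"
    then have "v $ 1 = 0 \<and> v $ 2 = 0" if "two_columns A p q *v v = 0" for v
      using independent_columns[OF assms, of p q "v $ 1" "v $ 2"] that by (simp add: mult)
    then show "\<forall>v. two_columns A p q *v v = 0 \<longrightarrow> v = 0"
      by (metis exhaust_2 vec_eq_iff zero_index)
  qed
  finally show ?thesis .
qed

section \<open>Nonnegative least squares on a given index set\<close>

lemma solutionsI:
  assumes "w \<in> P" "supp w \<subseteq> J"
    and "\<And>v. v \<in> P \<Longrightarrow> supp v \<subseteq> J \<Longrightarrow> norm (A *v w - y) \<le> norm (A *v v - y)"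
  shows "w \<in> solutions P A y J"
  using assms by (auto simp: solutions_def is_arg_min_linorder power_mono)

lemma solutionsD:
  assumes "w \<in> solutions P A y J"
  shows "w \<in> P" "supp w \<subseteq> J"
    and "\<And>v. v \<in> P \<Longrightarrow> supp v \<subseteq> J \<Longrightarrow> norm (A *v w - y) \<le> norm (A *v v - y)"
  using assms by (auto simp: solutions_def is_arg_min_linorder)

text \<open>Exhibits the feasible set as a finitely generated cone, because linear images of such
  cones are again finitely generated and hence closed.\<close>

lemma nonneg_orthant_supp_eq_hull:
  "{w :: real^'n. w \<in> nonneg_orthant \<and> supp w \<subseteq> J} = convex_cone hull ((\<lambda>i. axis i 1) ` J)"
  (is "?C = ?H")
proof
  show "?C \<subseteq> ?H"
  proof
    fix w :: "real^'n" assume w: "w \<in> ?C"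
    have "(\<Sum>i\<in>K. w $ i *\<^sub>R axis i 1) \<in> ?H" if "K \<subseteq> J" for K
      using finite[of K] that
    proof (induction K)
      case (insert i K)
      moreover have "w $ i *\<^sub>R axis i 1 \<in> ?H"
        using w insert.prems
        by (intro convex_cone_hull_mul hull_inc) (auto simp: nonneg_orthant_def)
      ultimately show ?case
        by (simp add: convex_cone_hull_add)
    qed (simp add: convex_cone_hull_contains_0)
    moreover have "(\<Sum>i\<in>J. w $ i *\<^sub>R axis i 1) = w"
    proof -
      \<comment> \<open>The column expansion of \<open>A *v w\<close>, applied to the identity
        matrix, expands \<open>w\<close> in the standard basis.\<close>
      have "column i (mat 1) = (axis i 1 :: real^'n)" for i
        by (simp add: column_def mat_def axis_def)
      then show ?thesis
        using matrix_vector_mult_supp[of w J "mat 1"] w by simp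
    qed
    ultimately show "w \<in> ?H"
      by (metis order_refl)
  qed
next
  have "convex_cone ?C"
    unfolding convex_cone_iff
    by (auto simp: nonneg_orthant_def supp_def subset_iff) (metis add_0)
  moreover have "(\<lambda>i. axis i 1) ` J \<subseteq> ?C"
    by (auto simp: nonneg_orthant_def supp_def axis_def split: if_splits)
  ultimately show "?H \<subseteq> ?C"
    by (rule hull_minimal[rotated])
qed

lemma solutions_nonempty:
  fixes A :: "real^'n^'m"
  shows "\<exists>w. w \<in> solutions nonneg_orthant A y J"
proof -
  define C where "C = {w :: real^'n. w \<in> nonneg_orthant \<and> supp w \<subseteq> J}"
  have "closed ((*v) A ` C)"
    unfolding C_def nonneg_orthant_supp_eq_hull
    by (subst convex_cone_hull_linear_image[symmetric]) (auto intro: closed_convex_cone_hull)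
  moreover have "(*v) A ` C \<noteq> {}"
    by (auto simp: C_def nonneg_orthant_def supp_def intro!: exI[of _ 0])
  ultimately obtain u where "u \<in> (*v) A ` C" "\<And>v. v \<in> (*v) A ` C \<Longrightarrow> dist y u \<le> dist y v"
    using distance_attains_inf by blast
  then obtain w where "w \<in> C" "\<And>v. v \<in> C \<Longrightarrow> dist y (A *v w) \<le> dist y (A *v v)"
    by blast
  then have "w \<in> solutions nonneg_orthant A y J"
    by (intro solutionsI) (auto simp: C_def dist_norm norm_minus_commute)
  then show ?thesis ..
qed

text \<open>Fixes one minimizer per index set, so that a run can be built by recursion on its index
  sets alone.\<close>

lemma solutions_choice:
  fixes A :: "real^'n^'m"
  obtains sol where "\<And>J. sol J \<in> solutions nonneg_orthant A y J"
  by (rule that[OF someI_ex[OF solutions_nonempty]])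

lemma solutions_empty:
  assumes "w \<in> solutions P A y {}"
  shows "w = 0"
  using solutionsD(2)[OF assms] by (auto simp: supp_def vec_eq_iff)

section \<open>Minimization along one coordinate and the selection rule\<close>

lemma norm_diff_scaleR_sq:
  fixes r a :: "'a::real_inner"
  assumes "norm a = 1"
  shows "(norm (r - t *\<^sub>R a))\<^sup>2 = (norm r)\<^sup>2 - (inner r a)\<^sup>2 + (t - inner r a)\<^sup>2"
proof -
  have "inner a a = 1"
    using assms by (simp add: dot_square_norm)
  then show ?thesis
    unfolding power2_norm_eq_inner
    by (simp add: inner_diff_left inner_diff_right inner_commute power2_eq_square algebra_simps)
qed

lemma pos_part_dist_le:
  fixes c t :: real
  assumes "0 \<le> t"
  shows "(pos_part c - c)\<^sup>2 \<le> (t - c)\<^sup>2"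
  using assms by (cases "0 \<le> c") (auto simp: abs_le_square_iff[symmetric])

text \<open>On a single ray the objective is a parabola in \<open>w $ p\<close> with vertex
  \<open>inner y (column p A)\<close>. Its unique minimizer over the half-line is the point nearest
  to the vertex.\<close>

lemma solutions_singleton:
  fixes A :: "real^'n^'m"
  assumes "unit_columns A"
    and w: "w \<in> solutions nonneg_orthant A y {p}"
  shows "w = pos_part (inner y (column p A)) *\<^sub>R axis p 1"
proof -
  define c where "c = inner y (column p A)"
  have unit: "norm (column p A) = 1"
    using assms(1) by (simp add: unit_columns_def)
  have val: "(norm (A *v v - y))\<^sup>2 = (norm y)\<^sup>2 - c\<^sup>2 + (v $ p - c)\<^sup>2" if "supp v \<subseteq> {p}" for v
    unfolding norm_minus_commute[of _ y] c_def
    using norm_diff_scaleR_sq[OF unit] matrix_vector_mult_supp[OF that, of A] by simp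
  let ?v = "pos_part c *\<^sub>R axis p 1 :: real^'n"
  have v: "?v \<in> nonneg_orthant" "supp ?v \<subseteq> {p}"
    by (auto simp: nonneg_orthant_def supp_def axis_def)
  have wp: "0 \<le> w $ p" "supp w \<subseteq> {p}"
    using solutionsD[OF w] by (auto simp: nonneg_orthant_def)
  have "(norm (A *v w - y))\<^sup>2 \<le> (norm (A *v ?v - y))\<^sup>2"
    using solutionsD(3)[OF w v] by (simp add: power_mono)
  then have "(w $ p - c)\<^sup>2 \<le> (pos_part c - c)\<^sup>2"
    using val[OF wp(2)] val[OF v(2)] by simp
  then have "\<bar>w $ p - c\<bar> \<le> \<bar>pos_part c - c\<bar>"
    by (simp add: power2_le_iff_abs_le abs_le_square_iff)
  \<comment> \<open>If \<open>c\<close> is nonnegative, the right-hand distance is 0; if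
    \<open>c\<close> is negative, the bound reads \<open>w $ p - c \<le> - c\<close>, which forces
    \<open>w $ p = 0\<close>.\<close>
  then have "w $ p = pos_part c"
    using wp(1) by (auto simp: max_def split: if_splits)
  then show ?thesis
    using wp(2) unfolding c_def by (auto simp: vec_eq_iff axis_def supp_def)
qed

text \<open>The side condition holds along the run: a column already selected is orthogonal to the residual
  as soon as its coefficient is positive.\<close>

lemma gstar_eq:
  fixes A :: "real^'n^'m"
  assumes "unit_columns A" "x \<in> nonneg_orthant"
    and "x $ j = 0 \<or> inner (y - A *v x) (column j A) = 0"
  shows "gstar nonneg_orthant A y x j =
    (norm (y - A *v x))\<^sup>2 - (pos_part (inner (y - A *v x) (column j A)))\<^sup>2"
proof -
  define r where "r = y - A *v x"
  define c where "c = inner r (column j A)"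
  have unit: "norm (column j A) = 1"
    using assms(1) by (simp add: unit_columns_def)
  have feas: "x + t *\<^sub>R axis j 1 \<in> nonneg_orthant \<longleftrightarrow> - x $ j \<le> t" for t
    using assms(2) by (auto simp: nonneg_orthant_def axis_def)
  have "y - A *v (x + t *\<^sub>R axis j 1) = r - t *\<^sub>R column j A" for t
    by (simp add: r_def algebra_simps matrix_vector_mult_scaleR matrix_vector_mult_basis)
  then have val: "(norm (y - A *v (x + t *\<^sub>R axis j 1)))\<^sup>2 = (norm r)\<^sup>2 - c\<^sup>2 + (t - c)\<^sup>2" for t
    using norm_diff_scaleR_sq[OF unit] by (simp add: c_def)
  have min: "(norm r)\<^sup>2 - c\<^sup>2 + (pos_part c - c)\<^sup>2 = (norm r)\<^sup>2 - (pos_part c)\<^sup>2"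
    by (auto simp: max_def)
  have xj: "0 \<le> x $ j"
    using assms(2) by (simp add: nonneg_orthant_def)
  \<comment> \<open>The best feasible step is \<open>max c (- x $ j)\<close>. It equals
    \<open>pos_part c\<close> when \<open>x $ j = 0\<close>, and also when \<open>c = 0\<close>,
    where both are 0.\<close>
  have cases: "x $ j = 0 \<or> c = 0"
    using assms(3) by (simp add: c_def r_def)
  have le: "(pos_part c - c)\<^sup>2 \<le> (t - c)\<^sup>2" if "- x $ j \<le> t" for t
    using cases that by (auto intro: pos_part_dist_le)
  have "gstar nonneg_orthant A y x j = (norm r)\<^sup>2 - (pos_part c)\<^sup>2"
    unfolding gstar_def val feas
  proof (rule Least_equality)
    show "\<exists>t. - x $ j \<le> t \<and> (norm r)\<^sup>2 - (pos_part c)\<^sup>2 = (norm r)\<^sup>2 - c\<^sup>2 + (t - c)\<^sup>2"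
      using xj min by (intro exI[of _ "pos_part c"]) auto
  next
    fix v assume "\<exists>t. - x $ j \<le> t \<and> v = (norm r)\<^sup>2 - c\<^sup>2 + (t - c)\<^sup>2"
    then show "(norm r)\<^sup>2 - (pos_part c)\<^sup>2 \<le> v"
      using le min by fastforce
  qed
  then show ?thesis
    by (simp add: c_def r_def)
qed

text \<open>The squared residual norm is common to all columns, so only the subtracted squares of
  positive parts are compared.\<close>

lemma is_arg_min_gstar_iff:
  fixes A :: "real^'n^'m"
  assumes "unit_columns A" "x \<in> nonneg_orthant"
    and "\<And>i. x $ i = 0 \<or> inner (y - A *v x) (column i A) = 0"
  shows "is_arg_min (gstar nonneg_orthant A y x) (\<lambda>_. True) j \<longleftrightarrow>
    (\<forall>i. pos_part (inner (y - A *v x) (column i A)) \<le> pos_part (inner (y - A *v x) (column j A)))"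
  by (simp add: is_arg_min_linorder gstar_eq[OF assms] abs_le_square_iff[symmetric])

lemma is_arg_min_gstar_0_iff:
  fixes A :: "real^'n^'m"
  assumes "unit_columns A"
  shows "is_arg_min (gstar nonneg_orthant A y 0) (\<lambda>_. True) j \<longleftrightarrow>
    (\<forall>i. pos_part (inner y (column i A)) \<le> pos_part (inner y (column j A)))"
  using is_arg_min_gstar_iff[OF assms, of 0 y j] by (simp add: nonneg_orthant_def)

lemma is_arg_min_gstar_axis_iff:
  fixes A :: "real^'n^'m" and y :: "real^'m"
  assumes "unit_columns A" "0 \<le> inner y (column p A)"
  defines "r \<equiv> y - inner y (column p A) *\<^sub>R column p A"
  shows "is_arg_min (gstar nonneg_orthant A y (inner y (column p A) *\<^sub>R axis p 1)) (\<lambda>_. True) j \<longleftrightarrow>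
    (\<forall>i. pos_part (inner r (column i A)) \<le> pos_part (inner r (column j A)))"
proof -
  let ?x = "inner y (column p A) *\<^sub>R axis p 1 :: real^'n"
  have r: "y - A *v ?x = r"
    by (simp add: r_def matrix_vector_mult_scaleR matrix_vector_mult_basis)
  have "?x \<in> nonneg_orthant"
    using assms(2) by (auto simp: nonneg_orthant_def axis_def)
  \<comment> \<open>Coordinates other than \<open>p\<close> vanish, and the residual of projecting
    \<open>y\<close> onto column \<open>p\<close> is orthogonal to that column.\<close>
  moreover have "?x $ i = 0 \<or> inner (y - A *v ?x) (column i A) = 0" for i
    unfolding r using inner_column_self[OF assms(1), of p]
    by (auto simp: r_def axis_def inner_diff_left)
  ultimately show ?thesis
    using is_arg_min_gstar_iff[OF assms(1), of ?x y j] unfolding r by blast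
qed

section \<open>Construction of runs with prescribed selections, and runs that fail\<close>

lemma matching_pursuit_exists:
  assumes "\<And>J. sol J \<in> solutions P A y J"
    and "\<And>x. is_arg_min (gstar P A y x) (\<lambda>_. True) (sel x)"
  obtains x j J where "matching_pursuit P A y x j J"
    and "\<And>k. J (Suc k) = insert (sel (sol (J k))) (J k)"
proof -
  \<comment> \<open>With \<open>sol\<close> fixed, the iterate is a function of the index set and
    the selection a function of the iterate, so the index sets alone determine the run.\<close>
  define J where "J = rec_nat {} (\<lambda>_ K. insert (sel (sol K)) K)"
  have J: "J 0 = {}" "J (Suc k) = insert (sel (sol (J k))) (J k)" for k
    by (simp_all add: J_def)
  \<comment> \<open>The shift \<open>k - 1\<close> undoes the \<open>Suc\<close> in
    \<open>j (Suc k)\<close>; its value at 0 is irrelevant. The start \<open>x 0 = 0\<close> holds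
    because \<open>sol {}\<close> has empty support.\<close>
  have "matching_pursuit P A y (\<lambda>k. sol (J k)) (\<lambda>k. sel (sol (J (k - 1)))) J"
    unfolding matching_pursuit_def using assms solutions_empty[OF assms(1)] J by auto
  then show thesis
    using J(2) that by blast
qed

text \<open>Supplies arbitrary selections wherever none is prescribed. Finiteness of the column
  index type suffices, even at points where \<open>gstar\<close> is unspecified.\<close>

lemma arg_min_choice:
  fixes f :: "'b \<Rightarrow> 'a::finite \<Rightarrow> real"
  obtains sel where "\<And>x. is_arg_min (f x) (\<lambda>_. True) (sel x)"
proof -
  have "\<exists>i. is_arg_min (f x) (\<lambda>_. True) i" for x
    using ex_is_arg_min_if_finite[of UNIV "f x"] by simp
  then show thesis
    by (rule that[OF someI_ex])
qed

text \<open>Index sets only grow: an outside column selected first stays in every later set, and the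
  initial empty set differs from the support as well.\<close>

lemma not_recovered_if_first_wrong:
  fixes A :: "real^'n^'m"
  assumes "unit_columns A" "k \<notin> supp z" "supp z \<noteq> {}"
    and "\<And>i. pos_part (inner (A *v z) (column i A)) \<le> pos_part (inner (A *v z) (column k A))"
  shows "\<not> recovered nonneg_orthant A z"
proof
  assume rec: "recovered nonneg_orthant A z"
  let ?P = "nonneg_orthant :: (real^'n) set" and ?y = "A *v z"
  obtain sol where sol: "\<And>J. sol J \<in> solutions ?P A ?y J"
    using solutions_choice[of A] by blast
  obtain f where f: "\<And>x. is_arg_min (gstar ?P A ?y x) (\<lambda>_. True) (f x)"
    using arg_min_choice[of "gstar ?P A ?y"] by blast
  \<comment> \<open>Only the selection at the zero iterate is overridden.\<close>
  have "is_arg_min (gstar ?P A ?y x) (\<lambda>_. True) ((f(0 := k)) x)" for x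
    using f assms(4) by (simp add: is_arg_min_gstar_0_iff[OF assms(1)])
  then obtain x j J where mp: "matching_pursuit ?P A ?y x j J"
    and J: "\<And>n. J (Suc n) = insert ((f(0 := k)) (sol (J n))) (J n)"
    by (rule matching_pursuit_exists[OF sol]) blast
  have J0: "J 0 = {}"
    using mp by (simp add: matching_pursuit_def)
  have "k \<in> J (Suc n)" for n
  proof (induction n)
    case 0
    show ?case
      using J[of 0] J0 solutions_empty[OF sol] by simp
  next
    case (Suc n)
    then show ?case
      using J[of "Suc n"] by simp
  qed
  then have "J s \<noteq> supp z" for s
    using J0 assms(2,3) by (cases s) auto
  with rec mp show False
    unfolding recovered_def by blast
qed

text \<open>The run that selects \<open>p\<close> and then \<open>k\<close> has \<open>{p}\<close>
  as its first nonempty index set, and all later sets contain \<open>k\<close>.\<close>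

lemma not_recovered_if_second_wrong:
  fixes A :: "real^'n^'m" and z :: "real^'n"
  defines "y \<equiv> A *v z"
  defines "r \<equiv> \<lambda>p. y - inner y (column p A) *\<^sub>R column p A"
  assumes "unit_columns A" "p \<noteq> q" "supp z = {p, q}" "k \<notin> {p, q}"
    and pos: "0 < inner y (column p A)"
    and first: "\<And>i. pos_part (inner y (column i A)) \<le> pos_part (inner y (column p A))"
    and second: "\<And>i. pos_part (inner (r p) (column i A)) \<le> pos_part (inner (r p) (column k A))"
  shows "\<not> recovered nonneg_orthant A z"
proof
  assume rec: "recovered nonneg_orthant A z"
  let ?P = "nonneg_orthant :: (real^'n) set"
  obtain sol where sol: "\<And>J. sol J \<in> solutions ?P A y J"
    using solutions_choice[of A] by blast
  obtain f where f: "\<And>x. is_arg_min (gstar ?P A y x) (\<lambda>_. True) (f x)"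
    using arg_min_choice[of "gstar ?P A y"] by blast
  define x1 where "x1 = (inner y (column p A) *\<^sub>R axis p 1 :: real^'n)"
  \<comment> \<open>Selections are attached to iterates, so prescribing different columns in steps
    one and two requires \<open>x1\<close> to be nonzero, which \<open>pos\<close> provides.\<close>
  define sel where "sel = f(0 := p, x1 := k)"
  have x1: "x1 \<noteq> 0" "sol {p} = x1"
    using solutions_singleton[OF assms(3) sol] pos by (auto simp: x1_def)
  have "is_arg_min (gstar ?P A y x1) (\<lambda>_. True) k"
    using second pos unfolding x1_def r_def
    by (subst is_arg_min_gstar_axis_iff[OF assms(3)]) auto
  then have "is_arg_min (gstar ?P A y x) (\<lambda>_. True) (sel x)" for x
    using f first by (simp add: sel_def is_arg_min_gstar_0_iff[OF assms(3)])
  then obtain x j J where mp: "matching_pursuit ?P A y x j J"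
    and J: "\<And>n. J (Suc n) = insert (sel (sol (J n))) (J n)"
    by (rule matching_pursuit_exists[OF sol]) blast
  have J0: "J 0 = {}"
    using mp by (simp add: matching_pursuit_def)
  then have J1: "J (Suc 0) = {p}"
    using J[of 0] solutions_empty[OF sol] x1(1) by (simp add: sel_def)
  have "k \<in> J (Suc (Suc n))" for n
  proof (induction n)
    case 0
    show ?case
      using J[of "Suc 0"] J1 x1(2) by (simp add: sel_def)
  next
    case (Suc n)
    then show ?case
      using J[of "Suc (Suc n)"] by simp
  qed
  moreover have "J (Suc 0) \<noteq> {p, q}"
    using J1 assms(4) by auto
  \<comment> \<open>The nested case split separates \<open>s = 0\<close>, \<open>s = 1\<close> and
    \<open>s \<ge> 2\<close>.\<close>
  ultimately have "J s \<noteq> supp z" for s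
    using J0 assms(5,6) by (cases s; cases "s - 1") auto
  with rec mp show False
    unfolding recovered_def y_def by blast
qed

section \<open>Sufficiency of the conditions\<close>

lemma solutions_recover:
  fixes A :: "real^'n^'m"
  assumes "unit_columns A" "\<bar>theta A p q\<bar> < 1" "p \<noteq> q"
    and "z \<in> nonneg_orthant" "supp z = {p, q}"
  shows "solutions nonneg_orthant A (A *v z) {p, q} = {z}"
proof -
  have "z \<in> solutions nonneg_orthant A (A *v z) {p, q}"
    using assms(4,5) by (intro solutionsI) auto
  moreover have "w = z" if w: "w \<in> solutions nonneg_orthant A (A *v z) {p, q}" for w
  proof -
    have supp_w: "supp w \<subseteq> {p, q}"
      using solutionsD(2)[OF w] .
    \<comment> \<open>\<open>z\<close> itself is feasible with value 0, so every minimizer has the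
      same image as \<open>z\<close>; independence of the two columns then gives equality.\<close>
    have "norm (A *v w - A *v z) \<le> 0"
      using solutionsD(3)[OF w assms(4)] assms(5) by simp
    then have "A *v w = A *v z"
      by simp
    then have "(w $ p - z $ p) *\<^sub>R column p A + (w $ q - z $ q) *\<^sub>R column q A = 0"
      using matrix_vector_mult_supp[OF supp_w, of A] matrix_vector_mult_supp[of z "{p, q}" A] assms(3,5)
      by (simp add: algebra_simps)
    from independent_columns[OF assms(1,2) this] have "w $ p = z $ p" "w $ q = z $ q"
      by simp_all
    moreover have "w $ i = 0" "z $ i = 0" if "i \<notin> {p, q}" for i
      using supp_w assms(5) that by (auto simp: supp_def)
    ultimately show ?thesis
      by (metis insertE singletonD vec_eq_iff)
  qed
  ultimately show ?thesis
    by blast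
qed

lemma residual_inner:
  fixes A :: "real^'n^'m"
  assumes "unit_columns A" "p \<noteq> q" "supp z = {p, q}"
  defines "y \<equiv> A *v z"
  shows "inner y (column i A) = theta A i p * z $ p + theta A i q * z $ q"
    and "inner (y - inner y (column p A) *\<^sub>R column p A) (column i A) =
           z $ q * (theta A i q - theta A p q * theta A i p)"
proof -
  have y: "y = z $ p *\<^sub>R column p A + z $ q *\<^sub>R column q A"
    using matrix_vector_mult_supp[of z "{p, q}" A] assms(2,3) by (simp add: y_def)
  show *: "inner y (column i A) = theta A i p * z $ p + theta A i q * z $ q" for i
    by (simp add: y theta_def inner_add_left inner_commute[of "column i A"])
  have "inner (y - inner y (column p A) *\<^sub>R column p A) (column i A) =
      inner y (column i A) - inner y (column p A) * theta A i p"
    by (simp add: inner_diff_left theta_def inner_commute[of "column i A"])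
  also have "\<dots> = z $ q * (theta A i q - theta A p q * theta A i p)"
    using inner_column_self[OF assms(1), of p] unfolding *
    by (simp add: theta_def algebra_simps)
  finally show "inner (y - inner y (column p A) *\<^sub>R column p A) (column i A) =
      z $ q * (theta A i q - theta A p q * theta A i p)" .
qed

lemma pos_part_mult:
  fixes a b :: real
  assumes "0 \<le> a"
  shows "pos_part (a * b) = a * pos_part b"
  using assms by (auto simp: max_def mult_le_0_iff zero_le_mult_iff)

text \<open>Stated for an ordered pair, so that both possible first selections are covered by
  exchanging \<open>p\<close> and \<open>q\<close>.\<close>

lemma second_selection:
  fixes A :: "real^'n^'m"
  assumes "unit_columns A" "\<bar>theta A p q\<bar> < 1" "p \<noteq> q" "supp z = {p, q}" "0 < z $ q"
    and iii: "\<And>k. k \<notin> {p, q} \<Longrightarrow> pos_part (theta A k q - theta A p q * theta A k p) < 1 - (theta A p q)\<^sup>2"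
    and mp: "matching_pursuit nonneg_orthant A (A *v z) x j J"
    and J1: "J 1 = {p}" and pos: "0 < inner (A *v z) (column p A)"
  shows "J 2 = {p, q}"
proof -
  define y where "y = A *v z"
  define r where "r = y - inner y (column p A) *\<^sub>R column p A"
  note step = mp[unfolded matching_pursuit_def]
  have "x 1 \<in> solutions nonneg_orthant A y {p}"
    using step J1 by (metis One_nat_def y_def)
  then have x1: "x 1 = inner y (column p A) *\<^sub>R axis p 1"
    using solutions_singleton[OF assms(1), of "x 1" y p] pos by (simp add: y_def)
  have ri: "pos_part (inner r (column i A)) = z $ q * pos_part (theta A i q - theta A p q * theta A i p)" for i
    using residual_inner(2)[OF assms(1,3,4)] assms(5) by (simp add: r_def y_def pos_part_mult)
  have rq: "pos_part (inner r (column q A)) = z $ q * (1 - (theta A p q)\<^sup>2)"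
    using inner_column_self[OF assms(1), of q] one_minus_theta_sq_pos[OF assms(2)] theta_commute[of A q p]
    by (simp add: ri theta_def[of A q q] power2_eq_square)
  have rp: "pos_part (inner r (column p A)) = 0"
    using inner_column_self[OF assms(1), of p] by (simp add: ri theta_def)
  have "is_arg_min (gstar nonneg_orthant A y (x 1)) (\<lambda>_. True) (j 2)"
    using step by (metis One_nat_def numeral_2_eq_2 y_def)
  then have le: "pos_part (inner r (column q A)) \<le> pos_part (inner r (column (j 2) A))"
    using is_arg_min_gstar_axis_iff[OF assms(1)] pos unfolding x1 r_def y_def by simp
  \<comment> \<open>Column \<open>q\<close> has a positive score; column \<open>p\<close> scores 0
    by orthogonality, and every outside column scores strictly less than \<open>q\<close> by
    \<open>iii\<close>.\<close>
  have "j 2 = q"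
  proof (rule ccontr)
    assume "j 2 \<noteq> q"
    have "z $ q * (1 - (theta A p q)\<^sup>2) > 0"
      using assms(5) one_minus_theta_sq_pos[OF assms(2)] by simp
    then have "j 2 \<noteq> p"
      using le rp rq by auto
    then show False
      using le iii[of "j 2"] \<open>j 2 \<noteq> q\<close> assms(5) unfolding rq
      unfolding ri by (auto simp: mult_le_cancel_left simp del: max_less_iff_conj)
  qed
  moreover have "J 2 = J 1 \<union> {j 2}"
    using step by (metis One_nat_def numeral_2_eq_2)
  ultimately show ?thesis
    using J1 by auto
qed

lemma recovered_if:
  fixes A :: "real^'n^'m"
  assumes "unit_columns A" "\<bar>theta A p q\<bar> < 1" "p \<noteq> q"
    and z: "z \<in> nonneg_orthant" "supp z = {p, q}"
    and ii: "\<And>k. k \<notin> {p, q} \<Longrightarrow> pos_part (inner (A *v z) (column k A)) <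
      max (pos_part (inner (A *v z) (column p A))) (pos_part (inner (A *v z) (column q A)))"
    and pos: "0 < max (pos_part (inner (A *v z) (column p A))) (pos_part (inner (A *v z) (column q A)))"
    and iii: "\<And>k. k \<notin> {p, q} \<Longrightarrow> pos_part (theta A k q - theta A p q * theta A k p) < 1 - (theta A p q)\<^sup>2"
      "\<And>k. k \<notin> {p, q} \<Longrightarrow> pos_part (theta A k p - theta A p q * theta A k q) < 1 - (theta A p q)\<^sup>2"
  shows "recovered nonneg_orthant A z"
  unfolding recovered_def
proof (intro allI impI)
  fix x j J
  assume mp: "matching_pursuit nonneg_orthant A (A *v z) x j J"
  note step = mp[unfolded matching_pursuit_def]
  have zpos: "0 < z $ p" "0 < z $ q"
  proof -
    have "0 \<le> z $ i" for i
      using z(1) by (simp add: nonneg_orthant_def)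
    moreover have "z $ p \<noteq> 0" "z $ q \<noteq> 0"
      using z(2) by (auto simp: supp_def)
    ultimately show "0 < z $ p" "0 < z $ q"
      by (simp_all add: order_less_le)
  qed
  have "is_arg_min (gstar nonneg_orthant A (A *v z) 0) (\<lambda>_. True) (j 1)"
    using step by (metis One_nat_def)
  then have max_j1: "pos_part (inner (A *v z) (column i A)) \<le> pos_part (inner (A *v z) (column (j 1) A))" for i
    by (simp add: is_arg_min_gstar_0_iff[OF assms(1)])
  have j1: "j 1 \<in> {p, q}"
    \<comment> \<open>An outside maximizer would dominate both support columns, against the strict
      inequality \<open>ii\<close>.\<close>
    using ii[of "j 1"] max_j1[of p] max_j1[of q] by (metis leD max.bounded_iff)
  have pos_j1: "0 < inner (A *v z) (column (j 1) A)"
    using pos max_j1[of p] max_j1[of q] by auto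
  have J1: "J 1 = {j 1}"
    using step by (metis One_nat_def sup_bot_left)
  have "J 2 = {p, q}"
  proof (cases "j 1 = p")
    case True
    then show ?thesis
      using second_selection[OF assms(1-3) z(2) zpos(2) iii(1) mp] J1 pos_j1 by simp
  next
    case False
    then have "j 1 = q"
      using j1 by simp
    then have "J 2 = {q, p}"
      using assms(2,3) z(2) zpos(1) iii(2) J1 pos_j1
      by (intro second_selection[OF assms(1) _ _ _ _ _ mp])
        (auto simp: theta_commute[of A q p])
    then show ?thesis
      by auto
  qed
  moreover have "solutions nonneg_orthant A (A *v z) (J s) = {z} \<and> x s = z" if "J s = supp z" for s
  proof -
    \<comment> \<open>The initial index set is empty, so \<open>s\<close> is a successor and
      \<open>x s\<close> is a minimizer over \<open>J s\<close> by construction.\<close>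
    have "s \<noteq> 0"
      using step that z(2) by (metis insert_not_empty)
    then obtain n where "s = Suc n"
      using not0_implies_Suc by blast
    then have "x s \<in> solutions nonneg_orthant A (A *v z) (J s)"
      using step by blast
    then show ?thesis
      using solutions_recover[OF assms(1-3) z] that z(2) by simp
  qed
  ultimately show "(\<exists>s. J s = supp z) \<and>
      (\<forall>s. J s = supp z \<longrightarrow> solutions nonneg_orthant A (A *v z) (J s) = {z} \<and> x s = z)"
    using z(2) by metis
qed

section \<open>Necessity of (i) and (iii)\<close>

lemma recovered_imp_unique_solution:
  fixes A :: "real^'n^'m"
  assumes "recovered nonneg_orthant A z"
  shows "solutions nonneg_orthant A (A *v z) (supp z) = {z}"
proof -
  let ?P = "nonneg_orthant :: (real^'n) set" and ?y = "A *v z"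
  obtain sol where "\<And>J. sol J \<in> solutions ?P A ?y J"
    using solutions_choice[of A] by blast
  moreover obtain f where "\<And>x. is_arg_min (gstar ?P A ?y x) (\<lambda>_. True) (f x)"
    using arg_min_choice[of "gstar ?P A ?y"] by blast
  \<comment> \<open>\<open>recovered\<close> quantifies over all runs, so information can be
    extracted from it only once some run is known to exist.\<close>
  ultimately obtain x j J where "matching_pursuit ?P A ?y x j J"
    by (rule matching_pursuit_exists) blast
  then show ?thesis
    using assms unfolding recovered_def by metis
qed

lemma recovered_imp_theta:
  fixes A :: "real^'n^'m"
  assumes "unit_columns A" "p \<noteq> q" "recovered nonneg_orthant A z"
    and "z \<in> nonneg_orthant" "supp z = {p, q}"
  shows "\<bar>theta A p q\<bar> < 1"
proof (rule ccontr)
  assume "\<not> \<bar>theta A p q\<bar> < 1"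
  note par = parallel_columns[OF assms(1) this]
  define t where "t = theta A p q"
  \<comment> \<open>For parallel columns, \<open>axis p 1 - t *\<^sub>R axis q 1\<close> lies in the
    kernel of \<open>A\<close>. The factor \<open>z $ q\<close> keeps \<open>w\<close> nonnegative
    because \<open>t \<le> 1\<close>, and makes it differ from \<open>z\<close>.\<close>
  define w where "w = z + z $ q *\<^sub>R (axis p 1 - t *\<^sub>R axis q 1)"
  have "A *v w = A *v z"
    by (simp add: w_def t_def par(2) matrix_vector_right_distrib matrix_vector_mult_diff_distrib
        matrix_vector_mult_scaleR matrix_vector_mult_basis)
  have "z $ i \<ge> 0" for i
    using assms(4) by (simp add: nonneg_orthant_def)
  moreover have "z $ q * t \<le> z $ q"
    using abs_theta_le_1[OF assms(1), of p q] \<open>0 \<le> z $ q\<close>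
    by (simp add: t_def mult_left_le)
  ultimately have "w \<in> nonneg_orthant"
    using assms(2) by (auto simp: nonneg_orthant_def w_def axis_def)
  moreover have "supp w \<subseteq> {p, q}"
    using assms(5) by (auto simp: supp_def w_def axis_def split: if_splits)
  ultimately have "w \<in> solutions nonneg_orthant A (A *v z) (supp z)"
    using \<open>A *v w = A *v z\<close> assms(5) by (intro solutionsI) auto
  then have "w = z"
    using recovered_imp_unique_solution[OF assms(3)] by blast
  then have "w $ p = z $ p"
    by simp
  then have "z $ q = 0"
    using assms(2) by (simp add: w_def axis_def)
  then show False
    using assms(5) by (auto simp: supp_def)
qed

text \<open>The weak bound \<open>ii\<close> is enough to make \<open>p\<close> an admissible first
  selection, since ties may be broken in its favour. A violating outside column would then allow a
  wrong second selection.\<close>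

lemma recovered_imp_iii:
  fixes A :: "real^'n^'m"
  assumes "unit_columns A" "p \<noteq> q" "\<bar>theta A p q\<bar> < 1"
    and z: "supp z = {p, q}" "z $ p = 1" "z $ q = 1"
    and rec: "recovered nonneg_orthant A z"
    and ii: "\<And>k. k \<notin> {p, q} \<Longrightarrow> pos_part (inner (A *v z) (column k A)) \<le> 1 + theta A p q"
    and "k \<notin> {p, q}"
  shows "pos_part (theta A k q - theta A p q * theta A k p) < 1 - (theta A p q)\<^sup>2"
proof (rule ccontr)
  define y where "y = A *v z"
  define r where "r = y - inner y (column p A) *\<^sub>R column p A"
  define f where "f i = pos_part (theta A i q - theta A p q * theta A i p)" for i
  assume "\<not> ?thesis"
  then have large: "1 - (theta A p q)\<^sup>2 \<le> f k"
    unfolding f_def by (rule leI)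
  have self: "theta A i i = 1" for i
    using inner_column_self[OF assms(1)] by (simp add: theta_def)
  have y_p: "inner y (column p A) = 1 + theta A p q" and y_q: "inner y (column q A) = 1 + theta A p q"
    using residual_inner(1)[OF assms(1,2) z(1)] z(2,3) self theta_commute[of A q p]
    by (simp_all add: y_def)
  have r_f: "pos_part (inner r (column i A)) = f i" for i
    using residual_inner(2)[OF assms(1,2) z(1)] z(3) by (simp add: r_def y_def f_def)
  \<comment> \<open>The violating column \<open>k\<close> need not be the best one, so it is
    replaced by an outside column \<open>k'\<close> of maximal score.\<close>
  have "Max (f ` (- {p, q})) \<in> f ` (- {p, q})"
    using assms(9) by (intro Max_in) auto
  then obtain k' where "k' \<in> - {p, q}" "Max (f ` (- {p, q})) = f k'"
    by blast
  moreover have "f i \<le> Max (f ` (- {p, q}))" if "i \<in> - {p, q}" for i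
    using that by (intro Max_ge) auto
  ultimately have k': "k' \<in> - {p, q}" "\<And>i. i \<in> - {p, q} \<Longrightarrow> f i \<le> f k'"
    by auto
  have "f k \<le> f k'"
    using k'(2) assms(9) by auto
  \<comment> \<open>The chain is
    \<open>f q = 1 - (theta A p q)\<^sup>2 \<le> f k \<le> f k'\<close>.\<close>
  then have f_q: "f q \<le> f k'"
    using large one_minus_theta_sq_pos[OF assms(3)] theta_commute[of A q p]
    by (simp add: f_def[of q] self power2_eq_square)
  have f_p: "f p \<le> f k'"
    by (simp add: f_def self)
  have "f i \<le> f k'" for i
    using k'(2)[of i] f_p f_q by (cases "i \<in> {p, q}") auto
  moreover have "pos_part (inner y (column i A)) \<le> pos_part (inner y (column p A))" for i
    using ii[of i] y_p y_q assms(3) by (cases "i \<in> {p, q}") (auto simp: y_def)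
  ultimately have "\<not> recovered nonneg_orthant A z"
    using k'(1) y_p assms(3) r_f z(1)
    by (intro not_recovered_if_second_wrong[OF assms(1,2)]) (auto simp: y_def r_def)
  then show False
    using rec ..
qed

section \<open>Assembly of the equivalence\<close>

theorem theorem5p3:
  fixes A :: "real^'n^'m" and i1 i2 :: 'n and S :: "'n set"
  assumes "unit_columns A"
    and "CARD('n) \<ge> 3"
    and "i1 \<noteq> i2"
    and "S = {i1, i2}"
  shows "(rank (two_columns A i1 i2) = 2 \<longleftrightarrow> \<bar>theta A i1 i2\<bar> < 1) \<and>
    ((\<forall>x. x \<in> nonneg_orthant \<and> x \<noteq> 0 \<and> supp x = S \<longrightarrow> recovered nonneg_orthant A x)
      \<longleftrightarrow>
        rank (two_columns A i1 i2) = 2 \<and>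
        (\<forall>z1 z2 :: real. z1 > 0 \<and> z2 > 0 \<longrightarrow>
           max (pos_part (z1 + theta A i1 i2 * z2)) (pos_part (theta A i1 i2 * z1 + z2))
           > Max ((\<lambda>j. pos_part (theta A j i1 * z1 + theta A j i2 * z2)) ` (- S))) \<and>
        1 - (theta A i1 i2)\<^sup>2
           > Max ((\<lambda>j. max (pos_part (theta A j i2 - theta A i1 i2 * theta A j i1))
                           (pos_part (theta A j i1 - theta A i1 i2 * theta A j i2))) ` (- S)))"
proof -
  let ?P = "nonneg_orthant :: (real^'n) set" and ?t = "theta A i1 i2"
  let ?corr = "\<lambda>a b j. pos_part (theta A j i1 * a + theta A j i2 * b)"
  let ?i = "rank (two_columns A i1 i2) = 2"
  let ?ii = "\<forall>z1 z2 :: real. z1 > 0 \<and> z2 > 0 \<longrightarrow>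
    max (pos_part (z1 + ?t * z2)) (pos_part (?t * z1 + z2)) > Max (?corr z1 z2 ` (- S))"
  let ?dev = "\<lambda>j. max (pos_part (theta A j i2 - ?t * theta A j i1))
    (pos_part (theta A j i1 - ?t * theta A j i2))"
  \<comment> \<open>With at least three columns the complement of \<open>S\<close> is nonempty, so
    the maxima over it are attained.\<close>
  have "card S < CARD('n)"
    using assms(2,3,4) by simp
  then have ne: "- S \<noteq> {}"
    by (metis Compl_empty_eq double_complement less_irrefl)
  have self: "theta A i i = 1" for i
    using inner_column_self[OF assms(1)] by (simp add: theta_def)
  have corr: "pos_part (inner (A *v z) (column j A)) = ?corr (z $ i1) (z $ i2) j" if "supp z = S" for z j
    using residual_inner(1)[OF assms(1,3)] that assms(4) by simp
  \<comment> \<open>Both sides of (ii) are thereby the same score function, evaluated on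
    \<open>S\<close> and on its complement.\<close>
  have corr_S: "?corr a b i1 = pos_part (a + ?t * b)" "?corr a b i2 = pos_part (?t * a + b)" for a b
    using self theta_commute[of A i2 i1] by simp_all
  have "?ii \<and> 1 - ?t\<^sup>2 > Max (?dev ` (- S))"
    if theta: "\<bar>?t\<bar> < 1" and rec: "\<And>z. z \<in> ?P \<Longrightarrow> supp z = S \<Longrightarrow> recovered ?P A z"
  proof -
    \<comment> \<open>Test vectors: (ii) at \<open>(a, b)\<close> follows from recovery of
      \<open>vec a b\<close>, and (iii) from recovery of \<open>vec 1 1\<close>.\<close>
    define vec where "vec a b = (a *\<^sub>R axis i1 1 + b *\<^sub>R axis i2 1 :: real^'n)" for a b
    have vec: "vec a b $ i1 = a" "vec a b $ i2 = b" for a b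
      using assms(3) by (simp_all add: vec_def axis_def)
    have rec_vec: "supp (vec a b) = S" "recovered ?P A (vec a b)" if "0 < a" "0 < b" for a b
    proof -
      show "supp (vec a b) = S"
        using that assms(3,4) by (auto simp: vec_def supp_def axis_def)
      moreover have "vec a b \<in> ?P"
        using that by (auto simp: vec_def nonneg_orthant_def axis_def)
      ultimately show "recovered ?P A (vec a b)"
        using rec by blast
    qed
    have ii: ?ii
    proof (intro allI impI)
      fix a b :: real
      assume ab: "a > 0 \<and> b > 0"
      show "max (pos_part (a + ?t * b)) (pos_part (?t * a + b)) > Max (?corr a b ` (- S))"
      proof (rule ccontr)
        assume "\<not> ?thesis"
        then have le: "pos_part (a + ?t * b) \<le> Max (?corr a b ` (- S))"
          "pos_part (?t * a + b) \<le> Max (?corr a b ` (- S))"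
          unfolding not_less max.bounded_iff by blast+
        have "Max (?corr a b ` (- S)) \<in> ?corr a b ` (- S)"
          using ne by (intro Max_in) auto
        \<comment> \<open>If (ii) fails, an outside column attaining the maximum dominates all
          columns and may be selected first.\<close>
        then obtain k where k: "k \<in> - S" "Max (?corr a b ` (- S)) = ?corr a b k"
          by blast
        have S_le: "?corr a b i1 \<le> ?corr a b k" "?corr a b i2 \<le> ?corr a b k"
          unfolding corr_S using le unfolding k(2) by blast+
        have "?corr a b i \<le> ?corr a b k" if "i \<in> - S" for i
          using Max_ge[of "?corr a b ` (- S)" "?corr a b i"] that k(2) by simp
        then have "?corr a b i \<le> ?corr a b k" for i
          using S_le assms(4) by (cases "i \<in> S") auto
        then have "\<not> recovered ?P A (vec a b)"
          using k(1) ab rec_vec(1)[of a b] assms(4) corr[of "vec a b"] vec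
          by (intro not_recovered_if_first_wrong[OF assms(1)]) auto
        then show False
          using rec_vec(2) ab by blast
      qed
    qed
    have ii1: "pos_part (inner (A *v vec 1 1) (column k A)) \<le> 1 + ?t" if "k \<notin> {i1, i2}" for k
    proof -
      have "?corr 1 1 k \<le> Max (?corr 1 1 ` (- S))"
        using that assms(4) by (intro Max_ge) auto
      also have "\<dots> \<le> max (pos_part (1 + ?t * 1)) (pos_part (?t * 1 + 1))"
        using ii[rule_format, of 1 1] by simp
      also have "\<dots> = 1 + ?t"
        using theta by simp
      finally show ?thesis
        using corr[OF rec_vec(1), of 1 1 k] vec by simp
    qed
    have "?dev k < 1 - ?t\<^sup>2" if "k \<in> - S" for k
    proof -
      have k: "k \<notin> {i1, i2}" "k \<notin> {i2, i1}"
        using that assms(4) by auto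
      have z: "supp (vec 1 1) = {i1, i2}" "supp (vec 1 1) = {i2, i1}" "recovered ?P A (vec 1 1)"
        using rec_vec[of 1 1] assms(4) by auto
      have "pos_part (theta A k i2 - ?t * theta A k i1) < 1 - ?t\<^sup>2"
        using recovered_imp_iii[OF assms(1,3) theta z(1) vec z(3) ii1 k(1)] .
      \<comment> \<open>The second half of (iii) is the first half with the two support columns
        exchanged.\<close>
      moreover have "pos_part (theta A k i1 - theta A i2 i1 * theta A k i2) < 1 - (theta A i2 i1)\<^sup>2"
      proof (rule recovered_imp_iii[OF assms(1) assms(3)[symmetric] _ z(2) vec(2,1) z(3) _ k(2)])
        show "\<bar>theta A i2 i1\<bar> < 1"
          using theta by (simp add: theta_commute[of A i2 i1])
        show "pos_part (inner (A *v vec 1 1) (column j A)) \<le> 1 + theta A i2 i1"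
          if "j \<notin> {i2, i1}" for j
          using ii1[of j] that by (simp add: theta_commute[of A i2 i1])
      qed
      ultimately show ?thesis
        unfolding theta_commute[of A i2 i1] max_less_iff_conj by blast
    qed
    then have "Max (?dev ` (- S)) < 1 - ?t\<^sup>2"
      using ne by (subst Max_less_iff) (auto simp del: max_less_iff_conj)
    with ii show ?thesis
      by blast
  qed
  \<comment> \<open>Condition (i) is derived separately, since the derivation of (ii) and (iii)
    above assumes it.\<close>
  moreover have "\<bar>?t\<bar> < 1" if "\<And>z. z \<in> ?P \<Longrightarrow> supp z = S \<Longrightarrow> recovered ?P A z"
  proof -
    let ?z = "axis i1 1 + axis i2 1 :: real^'n"
    have "?z \<in> ?P" "supp ?z = {i1, i2}"
      using assms(3) by (auto simp: nonneg_orthant_def supp_def axis_def)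
    then show ?thesis
      using recovered_imp_theta[OF assms(1,3)] that assms(4) by blast
  qed
  moreover have "recovered ?P A z"
    if "\<bar>?t\<bar> < 1" ?ii "1 - ?t\<^sup>2 > Max (?dev ` (- S))" and z: "z \<in> ?P" "supp z = S" for z
  proof -
    have zpos: "0 < z $ i1 \<and> 0 < z $ i2"
      using z assms(4) by (force simp: nonneg_orthant_def supp_def order_less_le)
    have dev: "?dev k < 1 - ?t\<^sup>2" if "k \<in> - S" for k
      using \<open>1 - ?t\<^sup>2 > Max (?dev ` (- S))\<close> ne that by (subst (asm) Max_less_iff) (auto simp del: max_less_iff_conj)
    have ii: "?corr (z $ i1) (z $ i2) k <
        max (pos_part (z $ i1 + ?t * z $ i2)) (pos_part (?t * z $ i1 + z $ i2))" if "k \<in> - S" for k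
      using \<open>?ii\<close>[rule_format, OF zpos] ne that by (subst (asm) Max_less_iff) (auto simp del: max_less_iff_conj)
    \<comment> \<open>Any outside column has a nonnegative score, so the strict inequality (ii)
      makes the larger of the two support scores positive.\<close>
    obtain k where "k \<in> - S"
      using ne by blast
    have "0 \<le> ?corr (z $ i1) (z $ i2) k"
      by simp
    also note ii[OF \<open>k \<in> - S\<close>]
    finally have pos: "0 < max (pos_part (z $ i1 + ?t * z $ i2)) (pos_part (?t * z $ i1 + z $ i2))" .
    show ?thesis
      using that(1) z pos ii dev assms(4)
      by (intro recovered_if[OF assms(1) _ assms(3)]) (simp_all only: corr corr_S, auto)
  qed
  moreover have "supp x = S \<Longrightarrow> x \<noteq> 0" for x :: "real^'n"
    using assms(4) by (auto simp: supp_def)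
  ultimately show ?thesis
    unfolding rank_two_columns_iff[OF assms(1)] by blast
qed

end
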